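(* Let $\mathcal C\subseteq\mathbb N$ be a finite ruleset such that $\mathrm{AP}(\mathcal C)=(p,t)$ (i.e. the Arithmetic-Periodicity Test is $(p,t)$-verified for $\mathcal C$), where $\max\mathcal C\le 4p$. Then the Sprague-Grundy sequence of the partition game with ruleset $\mathcal C$ is purely arithmetic-periodic with period $p$ and saltus $2^t$, i.e. $\mathcal G(n+p)=\mathcal G(n)+2^t$ for all $n\ge1$.
   Context: $\mathbb N=\{1,2,\ldots\}$ and $\mathbb N_0=\mathbb N\cup\{0\}$. A ruleset is a set $\mathcal C\subseteq\mathbb N$ of allowed cut-numbers. In the partition game with ruleset $\mathcal C$, a $c$-cut ($c\in\mathcal C$) of a heap of size $n$ is an option $O_n=(n_0,\ldots,n_c)$ consisting of $c+1$ heaps of positive integer sizes with $n_0+\cdots+n_c=n$. The Sprague-Grundy value of a sum of heaps is $\mathcal G(n_0,\ldots,n_c)=\mathcal G(n_0)\oplus\cdots\oplus\mathcal G(n_c)$, where $\oplus$ is nim-sum (bitwise XOR), and for a single heap of size $n\ge1$, $\mathcal G(n)=\operatorname{mex}\{\mathcal G(O_n)\mid O_n \text{ a } c\text{-cut of } n,\ c\in\mathcal C\}$, where $\operatorname{mex}(U)=\min(\mathbb N_0\setminus U)$. Arithmetic-Periodicity Test: for a finite ruleset $\mathcal C$, suppose there exist a smallest positive integer $p$ and a power of two $s=2^t$, $t\in\mathbb N_0$, $1\le s\le p$, such that (for heap sizes $n\in\mathbb N$; intervals denote integer intervals) AP1: for all $1\le n\le 3p$, $\mathcal G(n+p)=\mathcal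 G(n)+s$; AP2: $\{\mathcal G(n)\mid 1\le n\le p\}=\{0,1,\ldots,s-1\}$; AP3: for all $n\in[3p+1,4p]$ and all $g\in[0,s-1]$ there is a $c$-cut $O_n$ of $n$ with $c\in\mathcal C$, $c\ge2$, such that $\mathcal G(O_n)=g$. Then the test is said to be $(p,t)$-verified for $\mathcal C$, written $\mathrm{AP}(\mathcal C)=(p,t)$. *)

theory Defs
  imports Main
begin

definition mex :: "nat set \<Rightarrow> nat" where
  "mex U = (LEAST k. k \<notin> U)"

definition nim_sum :: "nat list \<Rightarrow> nat" where
  "nim_sum gs = foldr Bit_Operations.xor gs 0"

text \<open>A \<open>c\<close>-cut of a heap of size \<open>n\<close> is the list \<open>(n\<^sub>0, \<dots>, n\<^sub>c)\<close> of the resulting heap sizes.\<close>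

definition is_cut :: "nat \<Rightarrow> nat \<Rightarrow> nat list \<Rightarrow> bool" where
  "is_cut c n xs \<longleftrightarrow> length xs = c + 1 \<and> (\<forall>m \<in> set xs. 1 \<le> m) \<and> sum_list xs = n"

text \<open>Cut-numbers are positive. The guard \<open>1 \<le> c\<close> only serves to make \<open>grundy\<close> below terminate for
  every argument; it is redundant for rulesets, which do not contain \<open>0\<close>.\<close>

definition options :: "nat set \<Rightarrow> nat \<Rightarrow> nat list set" where
  "options C n = {xs. \<exists>c \<in> C. 1 \<le> c \<and> is_cut c n xs}"

lemma options_less:
  assumes "xs \<in> options C n" and "m \<in> set xs"
  shows "m < n"
proof -
  obtain c where c: "1 \<le> c" "length xs = c + 1" "\<forall>k \<in> set xs. 1 \<le> k" "sum_list xs = n"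
    using assms(1) by (auto simp: options_def is_cut_def)
  obtain ys zs where xs: "xs = ys @ m # zs"
    using assms(2) by (meson split_list)
  then have "ys @ zs \<noteq> []"
    using c(1,2) by auto
  then obtain k where k: "k \<in> set (ys @ zs)"
    using list.set_sel(1) by blast
  have "1 \<le> k"
    using c(3) k xs by auto
  also have "k \<le> sum_list (ys @ zs)"
    using k by (intro member_le_sum_list) simp_all
  finally show ?thesis
    using c(4) xs by simp
qed

text \<open>Heap size \<open>0\<close> does not occur in the game; there are no cuts of \<open>0\<close>, so \<open>grundy C 0 = 0\<close>.\<close>

function grundy :: "nat set \<Rightarrow> nat \<Rightarrow> nat" where
  "grundy C n = mex ((\<lambda>xs. nim_sum (map (grundy C) xs)) ` options C n)"
  by pat_completeness auto
termination
  by (relation "measure snd") (auto simp: options_less)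

declare grundy.simps [simp del]

definition grundy_sum :: "nat set \<Rightarrow> nat list \<Rightarrow> nat" where
  "grundy_sum C xs = nim_sum (map (grundy C) xs)"

definition AP1 :: "nat set \<Rightarrow> nat \<Rightarrow> nat \<Rightarrow> bool" where
  "AP1 C p s \<longleftrightarrow> (\<forall>n \<in> {1..3 * p}. grundy C (n + p) = grundy C n + s)"

definition AP2 :: "nat set \<Rightarrow> nat \<Rightarrow> nat \<Rightarrow> bool" where
  "AP2 C p s \<longleftrightarrow> grundy C ` {1..p} = {0..<s}"

definition AP3 :: "nat set \<Rightarrow> nat \<Rightarrow> nat \<Rightarrow> bool" where
  "AP3 C p s \<longleftrightarrow> (\<forall>n \<in> {3 * p + 1..4 * p}. \<forall>g \<in> {0..<s}.
     \<exists>c \<in> C. 2 \<le> c \<and> (\<exists>xs. is_cut c n xs \<and> grundy_sum C xs = g))"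

definition AP_conditions :: "nat set \<Rightarrow> nat \<Rightarrow> nat \<Rightarrow> bool" where
  "AP_conditions C p t \<longleftrightarrow>
     1 \<le> p \<and> 2 ^ t \<le> p \<and> AP1 C p (2 ^ t) \<and> AP2 C p (2 ^ t) \<and> AP3 C p (2 ^ t)"

text \<open>\<open>AP_verified C p t\<close> renders \<open>AP(C) = (p, t)\<close>: \<open>p\<close> is the smallest positive integer for which the
  conditions hold with some power of two. The exponent \<open>t\<close> is then unique, by \<open>AP2\<close>.\<close>

definition AP_verified :: "nat set \<Rightarrow> nat \<Rightarrow> nat \<Rightarrow> bool" where
  "AP_verified C p t \<longleftrightarrow>
     AP_conditions C p t \<and> (\<forall>q t'. AP_conditions C q t' \<longrightarrow> p \<le> q)"

end

theory Submission
  imports Defs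
begin

text \<open>
  Write a heap as \<open>m = q p + \<rho>\<close> with \<open>1 \<le> \<rho> \<le> p\<close>, and put \<open>s = 2\<^sup>t\<close>. Pure arithmetic periodicity
  says that \<open>m\<close> has value \<open>s q + g\<close>, where \<open>g < s\<close> is the value of the residue \<open>\<rho>\<close>. As \<open>s\<close> is a
  power of two, nim-sums of such values are computed separately on the quotients and on the values
  of the residues.

  The key observation is that the quotients of a cut can be redistributed freely. Consider a heap
  \<open>n = r + k p\<close> with \<open>1 \<le> r \<le> p\<close>, such that periodicity is known for all smaller heaps. A cut of \<open>n\<close> consists
  of residues that add up to \<open>r + d p\<close> for some \<open>d \<le> k\<close>, the carry, and quotients that add up to
  \<open>k - d\<close>. Conversely, the same residues together with \<^emph>\<open>any\<close> quotients of the right total form a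
  cut of \<open>n\<close>. So the residues of a cut of a small heap \<open>r + k' p\<close>, with \<open>k' \<le> 3\<close>, serve all larger
  heaps of the same class, and the only thing left to control is the nim-sum of the quotients
  (\<open>residue_cut_of_cut\<close> and \<open>cut_of_residue_cut\<close>).

  The value \<open>s k + \<G>(r)\<close> is not attained by a cut of \<open>n\<close>: a nim-sum is at most the sum, so the
  quotients would add up to \<open>k\<close>, the carry would be \<open>0\<close>, and the residues alone would be a cut of
  \<open>r\<close> with value \<open>\<G>(r)\<close>.

  Every smaller value \<open>s h + g\<close> with \<open>g < s\<close> is attained. If \<open>h = k\<close>, then \<open>g < \<G>(r)\<close>, and a cut of
  \<open>r\<close> with value \<open>g\<close> can take the quotients \<open>(k, 0, \<dots>, 0)\<close>. If \<open>h < k\<close>, note that a nim-sum has the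
  parity of the sum, so the parity of the carry must be that of \<open>k - h\<close>. With at least three
  heaps and a carry \<open>d \<le> k - h\<close> of that parity, the quotients \<open>(h, x, x, 0, \<dots>, 0)\<close> have the right
  total for a suitable \<open>x\<close>, and nim-sum \<open>h\<close>. For odd \<open>k - h \<ge> 3\<close>, such residues are provided by
  AP3. For \<open>k - h = 1\<close>, the heap \<open>r + p\<close> provides carry \<open>1\<close>, and two heaps are enough. For even
  \<open>k - h\<close>, the heap \<open>r + 3 p\<close> has a cut of value \<open>s + g\<close>, and this cut has carry \<open>0\<close> or \<open>2\<close> and
  cannot have only two heaps.
\<close>

section \<open>Nim-sums of lists\<close>

lemma nim_sum_simps [simp]:
  "nim_sum [] = 0"
  "nim_sum (x # xs) = Bit_Operations.xor x (nim_sum xs)"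
  by (simp_all add: nim_sum_def)

lemma nim_sum_replicate_0 [simp]: "nim_sum (replicate n 0) = 0"
  by (induction n) auto

lemma xor_le_add: "Bit_Operations.xor x y \<le> x + (y :: nat)"
proof (induction x arbitrary: y rule: less_induct)
  case (less x)
  show ?case
  proof (cases "x = 0")
    case False
    have "Bit_Operations.xor (x div 2) (y div 2) \<le> x div 2 + y div 2"
      using False by (intro less) simp
    then have "Bit_Operations.xor x y \<le> of_bool (odd x \<noteq> odd y) + 2 * (x div 2 + y div 2)"
      by (subst xor_rec) simp
    also have "\<dots> \<le> x + y"
      by (cases "odd x"; cases "odd y") (auto elim!: oddE evenE)
    finally show ?thesis .
  qed simp
qed

lemma nim_sum_le_sum_list: "nim_sum xs \<le> sum_list xs"
  by (induction xs) (auto intro: order_trans[OF xor_le_add])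

lemma even_nim_sum_iff: "even (nim_sum xs) \<longleftrightarrow> even (sum_list xs)"
  by (induction xs) (auto simp: even_xor_iff)

lemma xor_scaled:
  assumes "g < 2 ^ t" and "g' < 2 ^ t"
  shows "Bit_Operations.xor (2 ^ t * q + g) (2 ^ t * q' + g')
       = 2 ^ t * Bit_Operations.xor q q' + Bit_Operations.xor g (g' :: nat)"
proof -
  let ?l = "Bit_Operations.xor (2 ^ t * q + g) (2 ^ t * q' + g')"
  have "?l = 2 ^ t * drop_bit t ?l + take_bit t ?l"
    by (simp add: drop_bit_eq_div take_bit_eq_mod)
  also have "drop_bit t ?l = Bit_Operations.xor q q'"
    unfolding drop_bit_xor using assms by (simp add: drop_bit_eq_div)
  also have "take_bit t ?l = Bit_Operations.xor g g'"
    unfolding take_bit_xor using assms by (simp add: take_bit_eq_mod)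
  finally show ?thesis .
qed

lemma nim_sum_less_power:
  "\<forall>g \<in> set gs. g < 2 ^ t \<Longrightarrow> nim_sum gs < 2 ^ t"
proof (induction gs)
  case (Cons g gs)
  then have "take_bit t (Bit_Operations.xor g (nim_sum gs)) = Bit_Operations.xor g (nim_sum gs)"
    by (simp add: take_bit_nat_eq_self)
  then show ?case
    by (metis nim_sum_simps(2) take_bit_nat_less_exp)
qed simp

lemma nim_sum_scaled:
  assumes "\<forall>(q, g) \<in> set zs. g < 2 ^ t"
  shows "nim_sum (map (\<lambda>(q, g). 2 ^ t * q + g) zs)
       = 2 ^ t * nim_sum (map fst zs) + nim_sum (map snd zs)"
  using assms
proof (induction zs)
  case (Cons z zs)
  have "nim_sum (map snd zs) < 2 ^ t"
    using Cons.prems by (intro nim_sum_less_power) auto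
  with Cons show ?case
    by (auto simp: xor_scaled)
qed simp

text \<open>Two equal entries cancel in the nim-sum but still contribute to the sum, which is why three
  heaps suffice to realise every nim-sum that size and parity admit.\<close>

lemma three_entries_with_nim_sum:
  assumes "3 \<le> l" and "h \<le> n" and "even (n - h)"
  shows "\<exists>qs. length qs = l \<and> sum_list qs = n \<and> nim_sum qs = (h :: nat)"
proof -
  obtain x where x: "n - h = 2 * x"
    using assms(3) by (elim evenE)
  let ?qs = "h # x # x # replicate (l - 3) 0"
  have "Bit_Operations.xor x (Bit_Operations.xor x 0) = 0"
    by simp
  then show ?thesis
    using assms x by (intro exI[of _ ?qs]) (auto simp: sum_list_replicate)
qed

lemma one_entry_with_nim_sum:
  assumes "1 \<le> l"
  shows "\<exists>qs. length qs = l \<and> sum_list qs = h \<and> nim_sum qs = (h :: nat)"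
  using assms by (intro exI[of _ "h # replicate (l - 1) 0"]) (auto simp: sum_list_replicate)

section \<open>The mex rule\<close>

lemma length_le_sum_list: "\<forall>m \<in> set xs. 1 \<le> m \<Longrightarrow> length xs \<le> sum_list (xs :: nat list)"
  by (induction xs) auto

lemma finitely_many_cuts: "finite (options C n)"
proof (rule finite_subset)
  show "options C n \<subseteq> {xs. set xs \<subseteq> {..n} \<and> length xs \<le> n}"
  proof
    fix xs assume xs: "xs \<in> options C n"
    then have "length xs \<le> n"
      by (auto simp: options_def is_cut_def intro: length_le_sum_list)
    then show "xs \<in> {xs. set xs \<subseteq> {..n} \<and> length xs \<le> n}"
      using options_less[OF xs] by (auto intro: less_imp_le)
  qed
qed (simp add: finite_lists_length_le)

lemma grundy_eq_mex: "grundy C n = mex (grundy_sum C ` options C n)"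
proof -
  have "grundy_sum C = (\<lambda>xs. nim_sum (map (grundy C) xs))"
    by (simp add: fun_eq_iff grundy_sum_def)
  then show ?thesis
    by (simp add: grundy.simps[of C n])
qed

lemma grundy_sum_option_neq:
  assumes "xs \<in> options C n"
  shows "grundy_sum C xs \<noteq> grundy C n"
proof -
  let ?U = "grundy_sum C ` options C n"
  obtain k where "k \<notin> ?U"
    using ex_new_if_finite[OF infinite_UNIV_nat finite_imageI[OF finitely_many_cuts]] by blast
  then have "(LEAST k. k \<notin> ?U) \<notin> ?U"
    by (rule LeastI)
  then show ?thesis
    using assms by (metis grundy_eq_mex imageI mex_def)
qed

lemma less_grundy_attained:
  assumes "v < grundy C n"
  obtains c xs where "c \<in> C" "1 \<le> c" "is_cut c n xs" "grundy_sum C xs = v"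
proof -
  have "v \<in> grundy_sum C ` options C n"
    using assms not_less_Least[of v "\<lambda>k. k \<notin> grundy_sum C ` options C n"]
    by (auto simp: grundy_eq_mex mex_def)
  then show ?thesis
    using that by (auto simp: options_def)
qed

lemma grundy_eqI:
  assumes "\<And>c xs. c \<in> C \<Longrightarrow> 1 \<le> c \<Longrightarrow> is_cut c n xs \<Longrightarrow> grundy_sum C xs \<noteq> v"
    and "\<And>u. u < v \<Longrightarrow> \<exists>c \<in> C. 1 \<le> c \<and> (\<exists>xs. is_cut c n xs \<and> grundy_sum C xs = u)"
  shows "grundy C n = v"
  unfolding grundy_eq_mex mex_def
proof (rule Least_equality)
  show "v \<notin> grundy_sum C ` options C n"
    using assms(1) by (auto simp: options_def)
next
  fix y assume y: "y \<notin> grundy_sum C ` options C n"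
  show "v \<le> y"
  proof (rule ccontr)
    assume "\<not> v \<le> y"
    then obtain c xs where "c \<in> C" "1 \<le> c" "is_cut c n xs" "grundy_sum C xs = y"
      using assms(2)[of y] by auto
    with y show False
      by (auto simp: options_def)
  qed
qed

section \<open>Separating residues from quotients\<close>

text \<open>The residues \<open>\<rho>s\<close> of a cut into \<open>c + 1\<close> heaps of some heap in the class of \<open>r\<close> modulo \<open>p\<close>. The
  carry \<open>d\<close> is the number of periods that the quotients lose to the residues.\<close>

definition residue_cut :: "nat set \<Rightarrow> nat \<Rightarrow> nat \<Rightarrow> nat \<Rightarrow> nat \<Rightarrow> nat \<Rightarrow> bool" where
  "residue_cut C p r c d g \<longleftrightarrow> c \<in> C \<and> 1 \<le> c \<and>
     (\<exists>\<rho>s. length \<rho>s = c + 1 \<and> set \<rho>s \<subseteq> {1..p} \<and> sum_list \<rho>s = r + d * p \<and> grundy_sum C \<rho>s = g)"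

definition periodic_below :: "nat set \<Rightarrow> nat \<Rightarrow> nat \<Rightarrow> nat \<Rightarrow> bool" where
  "periodic_below C p s n \<longleftrightarrow>
     (\<forall>q \<rho>. \<rho> \<in> {1..p} \<longrightarrow> q * p + \<rho> < n \<longrightarrow> grundy C (q * p + \<rho>) = s * q + grundy C \<rho>)"

lemma grundy_sum_quotients_residues:
  assumes "periodic_below C p (2 ^ t) n"
    and "\<forall>\<rho> \<in> {1..p}. grundy C \<rho> < 2 ^ t"
    and "\<forall>(q, \<rho>) \<in> set zs. \<rho> \<in> {1..p} \<and> q * p + \<rho> < n"
  shows "grundy_sum C (map (\<lambda>(q, \<rho>). q * p + \<rho>) zs)
       = 2 ^ t * nim_sum (map fst zs) + grundy_sum C (map snd zs)"
proof -
  let ?ws = "map (\<lambda>(q, \<rho>). (q, grundy C \<rho>)) zs"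
  have "map (grundy C) (map (\<lambda>(q, \<rho>). q * p + \<rho>) zs) = map (\<lambda>(q, g). 2 ^ t * q + g) ?ws"
    using assms(1,3) by (auto simp: periodic_below_def)
  moreover have "map fst ?ws = map fst zs" "map snd ?ws = map (grundy C) (map snd zs)"
    by auto
  moreover have "\<forall>(q, g) \<in> set ?ws. g < 2 ^ t"
    using assms(2,3) by auto
  ultimately show ?thesis
    unfolding grundy_sum_def by (metis nim_sum_scaled)
qed

lemma sum_list_quotients_residues:
  "sum_list (map (\<lambda>(q, \<rho>). q * p + \<rho>) zs) = sum_list (map fst zs) * p + sum_list (map snd zs :: nat list)"
  by (induction zs) (auto simp: algebra_simps)

lemma residue_cut_of_cut:
  assumes "periodic_below C p (2 ^ t) n"
    and "\<forall>\<rho> \<in> {1..p}. grundy C \<rho> < 2 ^ t"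
    and "1 \<le> p" and "r \<in> {1..p}" and n: "n = k * p + r"
    and c: "c \<in> C" "1 \<le> c" and cut: "is_cut c n xs"
  obtains d g qs where "residue_cut C p r c d g" "g < 2 ^ t"
    "length qs = c + 1" "sum_list qs + d = k" "grundy_sum C xs = 2 ^ t * nim_sum qs + g"
proof -
  \<comment> \<open>Residues run over \<open>1, \<dots>, p\<close>, hence the shift by one.\<close>
  define zs where "zs = map (\<lambda>m. ((m - 1) div p, (m - 1) mod p + 1)) xs"
  have pos: "\<forall>m \<in> set xs. 1 \<le> m" and len: "length xs = c + 1" and sum: "sum_list xs = n"
    using cut by (auto simp: is_cut_def)
  have split: "(m - 1) div p * p + ((m - 1) mod p + 1) = m" if "1 \<le> m" for m
    using that div_mult_mod_eq[of "m - 1" p] by linarith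
  have xs: "map (\<lambda>(q, \<rho>). q * p + \<rho>) zs = xs"
    using pos split by (auto simp: zs_def intro!: map_idI)
  have less: "m < n" if "m \<in> set xs" for m
    using that c cut by (intro options_less[of xs C n m]) (auto simp: options_def)
  have res: "\<rho> \<in> {1..p}" if "(q, \<rho>) \<in> set zs" for q \<rho>
    using that \<open>1 \<le> p\<close> by (auto simp: zs_def Suc_le_eq)
  have zs: "\<forall>(q, \<rho>) \<in> set zs. \<rho> \<in> {1..p} \<and> q * p + \<rho> < n"
  proof (clarify, intro conjI)
    fix q \<rho> assume "(q, \<rho>) \<in> set zs"
    then show "\<rho> \<in> {1..p}" by (rule res)
    from \<open>(q, \<rho>) \<in> set zs\<close> have "q * p + \<rho> \<in> set (map (\<lambda>(q, \<rho>). q * p + \<rho>) zs)"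
      by force
    then show "q * p + \<rho> < n"
      using xs less by simp
  qed
  define Q where "Q = sum_list (map fst zs)"
  have total: "Q * p + sum_list (map snd zs) = k * p + r"
    using sum_list_quotients_residues[of p zs] xs sum n by (simp add: Q_def)
  have "1 \<le> sum_list (map snd zs)"
    using length_le_sum_list[of "map snd zs"] res len by (force simp: zs_def)
  then have "Q * p < Suc k * p"
    using total \<open>r \<in> {1..p}\<close> by simp
  then have "Q \<le> k"
    by (simp del: mult_Suc)
  then have "sum_list (map snd zs) = r + (k - Q) * p"
    using total by (simp add: diff_mult_distrib)
  moreover have "set (map snd zs) \<subseteq> {1..p}"
    using res by force
  moreover have "length zs = c + 1"
    using len by (simp add: zs_def)
  ultimately have "residue_cut C p r c (k - Q) (grundy_sum C (map snd zs))"
    using c by (auto simp: residue_cut_def intro!: exI[of _ "map snd zs"])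
  moreover have "grundy_sum C (map snd zs) < 2 ^ t"
    unfolding grundy_sum_def using res assms(2) by (intro nim_sum_less_power) force
  ultimately show ?thesis
    using that[of "k - Q" _ "map fst zs"] grundy_sum_quotients_residues[OF assms(1,2) zs]
      xs \<open>Q \<le> k\<close> \<open>length zs = c + 1\<close> by (simp add: Q_def)
qed

text \<open>The quotients \<open>qs\<close> need not be related to those of the cut that the residues were taken from;
  only their total matters.\<close>

lemma cut_of_residue_cut:
  assumes "periodic_below C p (2 ^ t) n"
    and "\<forall>\<rho> \<in> {1..p}. grundy C \<rho> < 2 ^ t"
    and n: "n = k * p + r"
    and rc: "residue_cut C p r c d g"
    and qs: "length qs = c + 1" "sum_list qs + d = k"
  obtains xs where "is_cut c n xs" "grundy_sum C xs = 2 ^ t * nim_sum qs + g"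
proof -
  obtain \<rho>s where \<rho>s: "length \<rho>s = c + 1" "set \<rho>s \<subseteq> {1..p}" "sum_list \<rho>s = r + d * p"
      "grundy_sum C \<rho>s = g" and c: "c \<in> C" "1 \<le> c"
    using rc by (auto simp: residue_cut_def)
  define zs where "zs = zip qs \<rho>s"
  have proj: "map fst zs = qs" "map snd zs = \<rho>s"
    using \<rho>s(1) qs(1) by (simp_all add: zs_def)
  let ?xs = "map (\<lambda>(q, \<rho>). q * p + \<rho>) zs"
  have res: "\<rho> \<in> {1..p}" if "(q, \<rho>) \<in> set zs" for q \<rho>
    using that \<rho>s(2) by (auto simp: zs_def dest: set_zip_rightD)
  have cut: "is_cut c n ?xs"
    unfolding is_cut_def
  proof (intro conjI)
    show "length ?xs = c + 1"
      using \<rho>s(1) qs(1) by (simp add: zs_def)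
    show "\<forall>m \<in> set ?xs. 1 \<le> m"
      using res by force
    show "sum_list ?xs = n"
      unfolding sum_list_quotients_residues proj n
      using \<rho>s(3) qs(2) by (auto simp: algebra_simps)
  qed
  have less: "m < n" if "m \<in> set ?xs" for m
    using that c cut by (intro options_less[of ?xs C n m]) (auto simp: options_def)
  have "\<forall>(q, \<rho>) \<in> set zs. \<rho> \<in> {1..p} \<and> q * p + \<rho> < n"
    using res less by force
  from grundy_sum_quotients_residues[OF assms(1,2) this] show ?thesis
    using that[OF cut] \<rho>s(4) by (simp add: proj)
qed

text \<open>The residues of two heaps exceed the class representative \<open>r \<ge> 1\<close> by less than \<open>2 p\<close>.\<close>

lemma residue_cut_carry_ge_2:
  assumes "residue_cut C p r c d g" and "1 \<le> r" and "2 \<le> d"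
  shows "2 \<le> c"
proof (rule ccontr)
  assume "\<not> 2 \<le> c"
  with assms(1) obtain \<rho>s where \<rho>s: "length \<rho>s = 2" "set \<rho>s \<subseteq> {1..p}" "sum_list \<rho>s = r + d * p"
    by (auto simp: residue_cut_def not_le less_Suc_eq_le numeral_2_eq_2)
  then obtain a b where "\<rho>s = [a, b]"
    by (auto simp: length_Suc_conv numeral_2_eq_2)
  with \<rho>s have "r + d * p \<le> 2 * p"
    by auto
  moreover have "2 * p \<le> d * p"
    using \<open>2 \<le> d\<close> by (rule mult_le_mono1)
  ultimately show False
    using \<open>1 \<le> r\<close> by linarith
qed

text \<open>Carry \<open>0\<close> means that the residues are themselves a cut of the heap \<open>r\<close>.\<close>

lemma residue_cut_no_carry_neq:
  assumes "residue_cut C p r c 0 g"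
  shows "g \<noteq> grundy C r"
proof -
  obtain \<rho>s where \<rho>s: "length \<rho>s = c + 1" "set \<rho>s \<subseteq> {1..p}" "sum_list \<rho>s = r" "grundy_sum C \<rho>s = g"
    and c: "c \<in> C" "1 \<le> c"
    using assms by (auto simp: residue_cut_def)
  then have "\<rho>s \<in> options C r"
    by (auto simp: options_def is_cut_def intro!: bexI[of _ c])
  with \<rho>s(4) grundy_sum_option_neq show ?thesis
    by blast
qed

section \<open>The Arithmetic-Periodicity Test\<close>

locale arithmetic_periodicity_test =
  fixes C :: "nat set" and p t :: nat
  assumes test: "AP_conditions C p t"
begin

lemma period_ge_1: "1 \<le> p"
  using test by (simp add: AP_conditions_def)

lemma residue_values: "\<forall>\<rho> \<in> {1..p}. grundy C \<rho> < 2 ^ t"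
  using test by (auto simp: AP_conditions_def AP2_def)

lemma grundy_add_period: "n \<in> {1..3 * p} \<Longrightarrow> grundy C (n + p) = grundy C n + 2 ^ t"
  using test by (simp add: AP_conditions_def AP1_def)

lemma grundy_small:
  assumes "r \<in> {1..p}" and "k \<le> 3"
  shows "grundy C (k * p + r) = 2 ^ t * k + grundy C r"
  using assms(2)
proof (induction k)
  case (Suc k)
  have "k * p \<le> 2 * p"
    using Suc.prems by (intro mult_le_mono1) simp
  then have "k * p + r \<in> {1..3 * p}"
    using assms(1) unfolding atLeastAtMost_iff by linarith
  then show ?case
    using Suc grundy_add_period[of "k * p + r"] by (simp add: algebra_simps)
qed simp

lemma periodic_below_small:
  assumes "n \<le> 4 * p + 1"
  shows "periodic_below C p (2 ^ t) n"
  unfolding periodic_below_def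
proof (intro allI impI)
  fix q \<rho> assume "\<rho> \<in> {1..p}" and "q * p + \<rho> < n"
  then have "q * p < 4 * p"
    using assms unfolding atLeastAtMost_iff by linarith
  then have "q \<le> 3"
    by simp
  with \<open>\<rho> \<in> {1..p}\<close> show "grundy C (q * p + \<rho>) = 2 ^ t * q + grundy C \<rho>"
    by (intro grundy_small)
qed

text \<open>The small heaps \<open>r + k p\<close> with \<open>k \<le> 3\<close> have known values, hence cuts of every smaller value;
  the residues of these cuts are the supply from which all larger heaps are served.\<close>

lemma cut_of_small_heap:
  assumes r: "r \<in> {1..p}" and "k \<le> 3" and "c \<in> C" "1 \<le> c"
    and "is_cut c (k * p + r) xs" and "grundy_sum C xs = 2 ^ t * h + g" and "g < 2 ^ t"
  obtains d qs where "residue_cut C p r c d g"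
    "length qs = c + 1" "sum_list qs + d = k" "nim_sum qs = h"
proof -
  have "k * p \<le> 3 * p"
    using \<open>k \<le> 3\<close> by (rule mult_le_mono1)
  then have "periodic_below C p (2 ^ t) (k * p + r)"
    using r unfolding atLeastAtMost_iff by (intro periodic_below_small) linarith
  from residue_cut_of_cut[OF this residue_values period_ge_1 r refl assms(3-5)]
  obtain d g' qs where *: "residue_cut C p r c d g'" "g' < 2 ^ t"
    "length qs = c + 1" "sum_list qs + d = k" "grundy_sum C xs = 2 ^ t * nim_sum qs + g'" .
  have "2 ^ t * nim_sum qs + g' = 2 ^ t * h + g"
    using *(5) assms(6) by simp
  then have "(2 ^ t * nim_sum qs + g') div 2 ^ t = (2 ^ t * h + g) div 2 ^ t"
    "(2 ^ t * nim_sum qs + g') mod 2 ^ t = (2 ^ t * h + g) mod 2 ^ t"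
    by simp_all
  then have "nim_sum qs = h" "g' = g"
    using *(2) \<open>g < 2 ^ t\<close> by simp_all
  with * that show ?thesis
    by blast
qed

lemma residue_cut_carry_0:
  assumes r: "r \<in> {1..p}" and g: "g < grundy C r"
  obtains c where "residue_cut C p r c 0 g"
proof -
  obtain c xs where c: "c \<in> C" "1 \<le> c" "is_cut c (0 * p + r) xs" "grundy_sum C xs = 2 ^ t * 0 + g"
    using less_grundy_attained[OF g] by auto
  have "g < 2 ^ t"
    using residue_values r g by (meson less_trans)
  from cut_of_small_heap[OF r _ c this] obtain d qs where "residue_cut C p r c d g"
    "sum_list qs + d = 0"
    by (metis zero_le)
  with that show ?thesis
    by simp
qed

text \<open>A cut of \<open>r + p\<close> of value \<open>g < s\<close> has quotients of total at most one and nim-sum \<open>0\<close>. The total is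
  even, so it is \<open>0\<close>, and the whole period has gone into the residues.\<close>

lemma residue_cut_carry_1:
  assumes r: "r \<in> {1..p}" and g: "g < 2 ^ t"
  obtains c where "residue_cut C p r c 1 g"
proof -
  have "g < grundy C (1 * p + r)"
    using grundy_small[OF r, of 1] g by simp
  then obtain c xs where c: "c \<in> C" "1 \<le> c" "is_cut c (1 * p + r) xs"
      "grundy_sum C xs = 2 ^ t * 0 + g"
    using less_grundy_attained[of g C "1 * p + r"] by auto
  from cut_of_small_heap[OF r _ c g] obtain d qs where qs: "residue_cut C p r c d g"
    "sum_list qs + d = 1" "nim_sum qs = 0"
    by (metis one_le_numeral)
  then have "even (sum_list qs)"
    using even_nim_sum_iff[of qs] by simp
  with qs(2) have "d = 1"
    by presburger
  with qs that show ?thesis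
    by simp
qed

text \<open>The cuts of \<open>r + 3 p\<close> that AP3 provides have quotients with nim-sum \<open>0\<close>, hence with even
  total, and the carry is what this total lacks to \<open>3\<close>.\<close>

lemma residue_cut_odd_carry:
  assumes r: "r \<in> {1..p}" and g: "g < 2 ^ t"
  obtains c d where "residue_cut C p r c d g" "2 \<le> c" "odd d" "d \<le> 3"
proof -
  have "3 * p + r \<in> {3 * p + 1..4 * p}" "g \<in> {0..<2 ^ t}"
    using r g by auto
  moreover have "AP3 C p (2 ^ t)"
    using test by (simp add: AP_conditions_def)
  ultimately obtain c xs where c: "c \<in> C" "2 \<le> c" "is_cut c (3 * p + r) xs" "grundy_sum C xs = g"
    unfolding AP3_def by meson
  have "1 \<le> c" "grundy_sum C xs = 2 ^ t * 0 + g"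
    using c by simp_all
  from cut_of_small_heap[OF r _ c(1) this(1) c(3) this(2) g] obtain d qs where
    qs: "residue_cut C p r c d g" "sum_list qs + d = 3" "nim_sum qs = 0"
    by (metis order_refl)
  then have "even (sum_list qs)"
    using even_nim_sum_iff[of qs] by simp
  with qs(2) have "odd d" "d \<le> 3"
    by presburger+
  with qs c that show ?thesis
    by blast
qed

text \<open>A cut of \<open>r + 3 p\<close> of value \<open>s + g\<close> has quotients with odd total at most \<open>3\<close> and nim-sum \<open>1\<close>. Two
  heaps cannot do this: they would have carry at most \<open>1\<close>, hence carry \<open>0\<close>, but two numbers with
  sum \<open>3\<close> are \<open>0, 3\<close> or \<open>1, 2\<close> and have nim-sum \<open>3\<close>.\<close>

lemma residue_cut_even_carry:
  assumes r: "r \<in> {1..p}" and g: "g < 2 ^ t"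
  obtains c d where "residue_cut C p r c d g" "2 \<le> c" "even d" "d \<le> 2"
proof -
  have "2 ^ t * 1 + g < grundy C (3 * p + r)"
    using grundy_small[OF r, of 3] g by simp
  then obtain c xs where c: "c \<in> C" "1 \<le> c" "is_cut c (3 * p + r) xs"
      "grundy_sum C xs = 2 ^ t * 1 + g"
    by (rule less_grundy_attained)
  from cut_of_small_heap[OF r _ c g] obtain d qs where qs: "residue_cut C p r c d g"
    "length qs = c + 1" "sum_list qs + d = 3" "nim_sum qs = 1"
    by (metis order_refl)
  then have "odd (sum_list qs)"
    using even_nim_sum_iff[of qs] by simp
  with qs(3) have d: "even d" "d \<le> 2"
    by presburger+
  have "2 \<le> c"
  proof (cases "d = 0")
    case True
    show ?thesis
    proof (rule ccontr)
      assume "\<not> 2 \<le> c"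
      with c(2) qs(2) have "length qs = 2"
        by simp
      then obtain a b where ab: "qs = [a, b]"
        by (auto simp: length_Suc_conv numeral_2_eq_2)
      with qs(3) True have "a = 0 \<and> b = 3 \<or> a = 1 \<and> b = 2 \<or> a = 2 \<and> b = 1 \<or> a = 3 \<and> b = 0"
        by auto
      with ab qs(4) show False
        by auto
    qed
  next
    case False
    with d have "2 \<le> d"
      by presburger
    with qs(1) r show ?thesis
      by (auto intro: residue_cut_carry_ge_2)
  qed
  with qs d that show ?thesis
    by blast
qed

lemma residues_and_quotients_for_value:
  assumes r: "r \<in> {1..p}" and v: "2 ^ t * h + g < 2 ^ t * k + grundy C r"
    and g: "g < 2 ^ t"
  obtains c d qs where "residue_cut C p r c d g"
    "length qs = c + 1" "sum_list qs + d = k" "nim_sum qs = h"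
proof -
  have "2 ^ t * h < 2 ^ t * (k + 1)"
    using v residue_values r by (fastforce simp: algebra_simps)
  then have "h \<le> k"
    by (simp only: mult_less_cancel1 less_Suc_eq_le flip: Suc_eq_plus1)
  then have "h = k \<or> h + 1 = k \<or> h < k \<and> even (k - h) \<or> h + 3 \<le> k \<and> odd (k - h)"
    by presburger
  then consider "h = k" | "h + 1 = k" | "h < k" "even (k - h)" | "h + 3 \<le> k" "odd (k - h)"
    by blast
  then show ?thesis
  proof cases
    case 1
    then have "g < grundy C r"
      using v by simp
    with r obtain c where "residue_cut C p r c 0 g"
      by (rule residue_cut_carry_0)
    with one_entry_with_nim_sum[of "c + 1" k] 1 that show ?thesis
      by fastforce
  next
    case 2
    obtain c where "residue_cut C p r c 1 g"
      using r g by (rule residue_cut_carry_1)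
    with one_entry_with_nim_sum[of "c + 1" h] 2 that show ?thesis
      by fastforce
  next
    case 3
    obtain c d where cd: "residue_cut C p r c d g" "2 \<le> c" "even d" "d \<le> 2"
      using r g by (rule residue_cut_even_carry)
    have "h + 2 \<le> k"
      using 3 by presburger
    with cd 3 have "3 \<le> c + 1" "h \<le> k - d" "even (k - d - h)" "d \<le> k"
      by auto
    with three_entries_with_nim_sum[of "c + 1" h "k - d"] cd(1) that show ?thesis
      by fastforce
  next
    case 4
    obtain c d where cd: "residue_cut C p r c d g" "2 \<le> c" "odd d" "d \<le> 3"
      using r g by (rule residue_cut_odd_carry)
    with 4 have "3 \<le> c + 1" "h \<le> k - d" "even (k - d - h)" "d \<le> k"
      by auto
    with three_entries_with_nim_sum[of "c + 1" h "k - d"] cd(1) that show ?thesis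
      by fastforce
  qed
qed

lemma grundy_step:
  assumes per: "periodic_below C p (2 ^ t) (k * p + r)" and r: "r \<in> {1..p}"
  shows "grundy C (k * p + r) = 2 ^ t * k + grundy C r"
proof (rule grundy_eqI)
  fix c xs assume "c \<in> C" "1 \<le> c" "is_cut c (k * p + r) xs"
  from residue_cut_of_cut[OF per residue_values period_ge_1 r refl this]
  obtain d g qs where *: "residue_cut C p r c d g" "g < 2 ^ t" "sum_list qs + d = k"
    "grundy_sum C xs = 2 ^ t * nim_sum qs + g"
    by metis
  show "grundy_sum C xs \<noteq> 2 ^ t * k + grundy C r"
  proof
    assume "grundy_sum C xs = 2 ^ t * k + grundy C r"
    with *(4) have eq: "2 ^ t * nim_sum qs + g = 2 ^ t * k + grundy C r"
      by simp
    have "grundy C r < 2 ^ t"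
      using residue_values r by blast
    with *(2) arg_cong[OF eq, of "\<lambda>x. x div 2 ^ t"] have "nim_sum qs = k"
      by simp
    with nim_sum_le_sum_list[of qs] *(3) have "d = 0"
      by simp
    with *(1) eq \<open>nim_sum qs = k\<close> residue_cut_no_carry_neq show False
      by auto
  qed
next
  fix u assume u: "u < 2 ^ t * k + grundy C r"
  have "u = 2 ^ t * (u div 2 ^ t) + u mod 2 ^ t" "u mod 2 ^ t < 2 ^ t"
    by simp_all
  with u residues_and_quotients_for_value[OF r, of "u div 2 ^ t" "u mod 2 ^ t"]
  obtain c d qs where rc: "residue_cut C p r c d (u mod 2 ^ t)"
    "length qs = c + 1" "sum_list qs + d = k" "nim_sum qs = u div 2 ^ t"
    by metis
  from cut_of_residue_cut[OF per residue_values refl rc(1-3)] obtain xs where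
    "is_cut c (k * p + r) xs" "grundy_sum C xs = u"
    using rc(4) by auto
  moreover have "c \<in> C" "1 \<le> c"
    using rc(1) by (simp_all add: residue_cut_def)
  ultimately show "\<exists>c \<in> C. 1 \<le> c \<and> (\<exists>xs. is_cut c (k * p + r) xs \<and> grundy_sum C xs = u)"
    by blast
qed

lemma periodic_below_all: "periodic_below C p (2 ^ t) n"
proof (induction n)
  case (Suc n)
  show ?case
    unfolding periodic_below_def
  proof (intro allI impI)
    fix q \<rho> assume \<rho>: "\<rho> \<in> {1..p}" and "q * p + \<rho> < Suc n"
    then consider "q * p + \<rho> < n" | "q * p + \<rho> = n"
      by linarith
    then show "grundy C (q * p + \<rho>) = 2 ^ t * q + grundy C \<rho>"
    proof cases
      case 1
      with Suc \<rho> show ?thesis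
        by (simp add: periodic_below_def)
    next
      case 2
      with Suc \<rho> show ?thesis
        by (intro grundy_step) simp_all
    qed
  qed
qed (simp add: periodic_below_def)

lemma grundy_add_period_all:
  assumes "1 \<le> n"
  shows "grundy C (n + p) = grundy C n + 2 ^ t"
proof -
  define q \<rho> where "q = (n - 1) div p" and "\<rho> = (n - 1) mod p + 1"
  have n: "n = q * p + \<rho>"
    using assms div_mult_mod_eq[of "n - 1" p] unfolding q_def \<rho>_def by linarith
  have "\<rho> \<in> {1..p}"
    using period_ge_1 by (auto simp: \<rho>_def Suc_le_eq)
  then have closed_form: "grundy C (k * p + \<rho>) = 2 ^ t * k + grundy C \<rho>" for k
    using periodic_below_all[of "Suc (k * p + \<rho>)"] by (simp add: periodic_below_def)
  have "n + p = Suc q * p + \<rho>"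
    using n by simp
  then show ?thesis
    using n closed_form[of q] closed_form[of "Suc q"] by (simp add: algebra_simps)
qed

end

theorem theorem9:
  fixes C :: "nat set" and p t :: nat
  assumes "0 \<notin> C"
    and "finite C"
    and "AP_verified C p t"
    and "Max C \<le> 4 * p"
  shows "\<forall>n\<ge>1. grundy C (n + p) = grundy C n + 2 ^ t"
proof -
  interpret arithmetic_periodicity_test C p t
    using assms(3) by unfold_locales (simp add: AP_verified_def)
  show ?thesis
    using grundy_add_period_all by blast
qed

end
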